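(* Let $n \geq 3$ and $t \geq 2$ be integers, let $k$ be an arbitrary field and let $R = k[x_1,\dots,x_n]$. Let $I_{n,t} = \langle \mathbf{x}^{e_1},\dots,\mathbf{x}^{e_n}\rangle \subseteq R$, where $\mathbf{x}^{e_i} = \prod_{j\in\{1,\dots,n\},\, j\neq i} x_j^t$. Then the integral closure $\overline{I}_{n,t}$ of $I_{n,t}$ has $\langle x_1,x_2,x_3\rangle$ as an embedded associated prime.
   Context: For $i \in \{1,\dots,n\}$, $e_i = (t,\dots,t,0,t,\dots,t)$ is the $n$-tuple with $0$ in the $i$-th coordinate and $t$ elsewhere, and $\mathbf{x}^{e_i} = x_1^t\cdots x_{i-1}^t x_{i+1}^t\cdots x_n^t$. The integral closure $\overline{I}$ of an ideal $I \subseteq R$ is the ideal of all $r \in R$ satisfying an equation $r^m + a_1 r^{m-1} + \cdots + a_m = 0$ with $m \geq 1$ and $a_j \in I^j$ for all $j$. An associated prime of an ideal $J$ means an element of $\mathrm{Ass}(R/J)$; it is embedded if it is not minimal among the elements of $\mathrm{Ass}(R/J)$, i.e. it properly contains another associated prime of $J$. *)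

theory Defs
  imports "HOL-Algebra.Ideal_Product" "HOL-Algebra.QuotRing" "HOL-Algebra.Module" "HOL-Library.Poly_Mapping"
begin

text \<open>
  A polynomial is a finitely supported map from monomials to coefficients, and a monomial is a
  finitely supported map from variable indices to exponents. Multiplication on
  \<^typ>\<open>(nat \<Rightarrow>\<^sub>0 nat) \<Rightarrow>\<^sub>0 'k::comm_ring_1\<close> is convolution.
\<close>

type_synonym 'k mpoly = "(nat \<Rightarrow>\<^sub>0 nat) \<Rightarrow>\<^sub>0 'k"

definition mpoly_var :: "nat \<Rightarrow> 'k::comm_ring_1 mpoly" where
  "mpoly_var i = Poly_Mapping.single (Poly_Mapping.single i 1) 1"

text \<open>The ring $k[x_1,\dots,x_n]$; the variables are indexed from 1.\<close>

definition mpoly_ring :: "nat \<Rightarrow> 'k::comm_ring_1 mpoly ring" where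
  "mpoly_ring n =
    \<lparr>carrier = {p. \<forall>m \<in> Poly_Mapping.keys p. Poly_Mapping.keys m \<subseteq> {1..n}},
     mult = (*), one = 1, zero = 0, add = (+)\<rparr>"

lemma cring_mpoly_ring: "cring (mpoly_ring n :: 'k::comm_ring_1 mpoly ring)"
proof (rule cringI)
  have minus: "- p \<in> carrier (mpoly_ring n)"
    if "p \<in> carrier (mpoly_ring n)" for p :: "'k mpoly"
    using that by (auto simp: mpoly_ring_def in_keys_iff)
  have plus: "p + q \<in> carrier (mpoly_ring n)"
    if "p \<in> carrier (mpoly_ring n)" "q \<in> carrier (mpoly_ring n)" for p q :: "'k mpoly"
    using that Poly_Mapping.keys_add[of p q] by (simp add: mpoly_ring_def) blast
  have times: "p * q \<in> carrier (mpoly_ring n)"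
    if pq: "p \<in> carrier (mpoly_ring n)" "q \<in> carrier (mpoly_ring n)" for p q :: "'k mpoly"
  proof -
    have "Poly_Mapping.keys m \<subseteq> {1..n}" if m: "m \<in> Poly_Mapping.keys (p * q)" for m
    proof -
      obtain a b where "m = a + b" "a \<in> Poly_Mapping.keys p" "b \<in> Poly_Mapping.keys q"
        using m keys_mult[of p q] by blast
      moreover have "Poly_Mapping.keys (a + b) \<subseteq> Poly_Mapping.keys a \<union> Poly_Mapping.keys b"
        by (rule Poly_Mapping.keys_add)
      ultimately show ?thesis
        using pq by (fastforce simp: mpoly_ring_def)
    qed
    then show ?thesis
      by (simp add: mpoly_ring_def)
  qed
  have ops: "mult (mpoly_ring n :: 'k mpoly ring) = (*)" "one (mpoly_ring n :: 'k mpoly ring) = 1"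
    "zero (mpoly_ring n :: 'k mpoly ring) = 0" "add (mpoly_ring n :: 'k mpoly ring) = (+)"
    by (simp_all add: mpoly_ring_def)
  have closed01: "(0 :: 'k mpoly) \<in> carrier (mpoly_ring n)" "(1 :: 'k mpoly) \<in> carrier (mpoly_ring n)"
    by (simp_all add: mpoly_ring_def)
  show "abelian_group (mpoly_ring n :: 'k mpoly ring)"
  proof (rule abelian_groupI)
    fix p :: "'k mpoly" assume "p \<in> carrier (mpoly_ring n)"
    then show "\<exists>q \<in> carrier (mpoly_ring n). q \<oplus>\<^bsub>mpoly_ring n\<^esub> p = \<zero>\<^bsub>mpoly_ring n\<^esub>"
      using minus[of p] by (intro bexI[of _ "- p"]) (simp_all add: ops)
  qed (simp_all add: ops closed01 plus add_ac)
  show "comm_monoid (mpoly_ring n :: 'k mpoly ring)"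
    by (rule comm_monoidI) (simp_all add: ops closed01 times mult_ac)
qed (simp add: mpoly_ring_def distrib_right)

text \<open>The powers of \<open>I\<close> are taken in the monoid of ideals under the ideal product.\<close>

definition integral_closure :: "('a, 'b) ring_scheme \<Rightarrow> 'a set \<Rightarrow> 'a set" where
  "integral_closure R I =
    {r \<in> carrier R. \<exists>m a. m \<ge> (1::nat) \<and>
       (\<forall>j \<in> {1..m}. a j \<in> I [^]\<^bsub>ideals_set R\<^esub> (j::nat)) \<and>
       r [^]\<^bsub>R\<^esub> m \<oplus>\<^bsub>R\<^esub> (\<Oplus>\<^bsub>R\<^esub>j \<in> {1..m}. a j \<otimes>\<^bsub>R\<^esub> r [^]\<^bsub>R\<^esub> (m - j)) = \<zero>\<^bsub>R\<^esub>}"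

definition Ass :: "('a, 'b) ring_scheme \<Rightarrow> ('a, 'c, 'd) module_scheme \<Rightarrow> 'a set set" where
  "Ass R M = {P. primeideal P R \<and>
     (\<exists>x \<in> carrier M. P = {r \<in> carrier R. r \<odot>\<^bsub>M\<^esub> x = \<zero>\<^bsub>M\<^esub>})}"

text \<open>The quotient $R/J$ with its \<open>R\<close>-module structure, for an ideal \<open>J\<close>.\<close>

definition quot_module :: "('a, 'b) ring_scheme \<Rightarrow> 'a set \<Rightarrow> ('a, 'a set) module" where
  "quot_module R J =
    \<lparr>carrier = carrier (R Quot J), mult = mult (R Quot J), one = one (R Quot J),
     zero = zero (R Quot J), add = add (R Quot J),
     smult = (\<lambda>r X. (J +>\<^bsub>R\<^esub> r) \<otimes>\<^bsub>R Quot J\<^esub> X)\<rparr>"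

lemma module_quot_module:
  assumes "cring R" "ideal J R"
  shows "module R (quot_module R J)"
proof -
  interpret R: cring R by fact
  interpret J: ideal J R by fact
  interpret Q: cring "R Quot J"
    by (rule J.quotient_is_cring) fact
  interpret h: ring_hom_ring R "R Quot J" "(+>\<^bsub>R\<^esub>) J"
    by (rule J.rcos_ring_hom_ring)
  have eqs: "carrier (quot_module R J) = carrier (R Quot J)"
    "add (quot_module R J) = add (R Quot J)" "zero (quot_module R J) = zero (R Quot J)"
    "smult (quot_module R J) = (\<lambda>r X. (J +>\<^bsub>R\<^esub> r) \<otimes>\<^bsub>R Quot J\<^esub> X)"
    by (simp_all add: quot_module_def)
  show ?thesis
  proof (rule moduleI)
    show "abelian_group (quot_module R J)"
    proof (rule abelian_groupI)
      fix X assume "X \<in> carrier (quot_module R J)"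
      then show "\<exists>Y \<in> carrier (quot_module R J). Y \<oplus>\<^bsub>quot_module R J\<^esub> X = \<zero>\<^bsub>quot_module R J\<^esub>"
        using Q.l_neg[of X] Q.a_inv_closed[of X] unfolding eqs by blast
    qed (simp_all add: eqs Q.a_ac)
  qed (simp_all add: eqs R.is_cring Q.l_distr Q.r_distr Q.m_assoc)
qed

definition associated_primes :: "('a, 'b) ring_scheme \<Rightarrow> 'a set \<Rightarrow> 'a set set" where
  "associated_primes R J = Ass R (quot_module R J)"

definition embedded_prime :: "('a, 'b) ring_scheme \<Rightarrow> 'a set \<Rightarrow> 'a set \<Rightarrow> bool" where
  "embedded_prime R J P \<longleftrightarrow>
     P \<in> associated_primes R J \<and> (\<exists>Q \<in> associated_primes R J. Q \<subset> P)"

definition I_nt :: "nat \<Rightarrow> nat \<Rightarrow> 'k::comm_ring_1 mpoly set" where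
  "I_nt n t = Idl\<^bsub>mpoly_ring n\<^esub> {\<Prod>j \<in> {1..n} - {i}. mpoly_var j ^ t | i. i \<in> {1..n}}"

end

theory Submission
  imports Defs
begin

text \<open>
  Call \<open>\<Sum>i. max 0 (t - a\<^sub>i)\<close> the deficit of a monomial \<open>x\<^sup>a\<close>. The whole argument rests on the
  description \<open>integral_closure_I_nt\<close>: the integral closure of \<open>I_nt n t\<close> is spanned by the monomials
  of deficit at most \<open>t\<close>, which are the lattice points of the Newton polyhedron of \<open>I_nt n t\<close>.
  A monomial of deficit \<open>t + 1\<close> lies just outside the closure. It is pushed inside exactly by
  multiplying it with a monomial that involves one of the variables \<open>x\<^sub>i\<close> with \<open>a\<^sub>i < t\<close>. Hence its
  annihilator modulo the closure is the prime generated by these variables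
  (\<open>associated_prime_of_deficits\<close>). Splitting \<open>t + 1\<close> as \<open>(t - 1) + 1 + 1\<close>, where
  \<open>t \<ge> 2\<close> makes all three parts positive, gives \<open>\<langle>x\<^sub>1, x\<^sub>2, x\<^sub>3\<rangle>\<close>. Splitting it as \<open>t + 1\<close> gives
  the associated prime \<open>\<langle>x\<^sub>1, x\<^sub>2\<rangle>\<close>, which is properly contained in the former.

  The description of the closure has two halves. For a set \<open>S\<close> of variables, the least total degree
  in \<open>S\<close> among the monomials of a polynomial is a valuation, and an element integral over an ideal
  has at least the value of that ideal (\<open>integral_closure_order_ge\<close>). Taking for \<open>S\<close> the set of
  variables that are deficient in a given monomial yields the bound on its deficit.

  Conversely, let all monomials of \<open>p\<close> have deficit at most \<open>t\<close>. There is a finite nonempty set \<open>C\<close>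
  of monomials such that the product of a monomial of \<open>p\<close> with one in \<open>C\<close> is always a multiple of
  a generator of \<open>I_nt n t\<close> times a member of \<open>C\<close> (\<open>exponent_translate\<close>). So multiplication by \<open>p\<close>
  acts on the span of \<open>C\<close> through a matrix with entries in the ideal, and the usual determinant
  argument makes \<open>p\<close> integral. The determinant is replaced by elimination without divisions
  (\<open>integral_equation_by_elimination\<close>): each step merely doubles the degree of the equation, and the
  coefficients remain in the correct powers of the ideal.
\<close>

section \<open>Polynomials and their supports\<close>

abbreviation "keys \<equiv> Poly_Mapping.keys"
abbreviation "lookup \<equiv> Poly_Mapping.lookup"
abbreviation "single \<equiv> Poly_Mapping.single"

definition exponent :: "nat set \<Rightarrow> (nat \<Rightarrow> nat) \<Rightarrow> nat \<Rightarrow>\<^sub>0 nat" where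
  "exponent A g = (\<Sum>j\<in>A. single j (g j))"

lemma lookup_exponent:
  "finite A \<Longrightarrow> lookup (exponent A g) k = (if k \<in> A then g k else 0)"
  by (simp add: exponent_def lookup_sum lookup_single when_def)

lemma keys_exponent: "finite A \<Longrightarrow> keys (exponent A g) \<subseteq> A"
  by (auto simp: in_keys_iff lookup_exponent split: if_splits)

lemma sum_of_monomials: "p = (\<Sum>a\<in>keys p. single a (lookup p a))"
  by (rule poly_mapping_eqI) (simp add: lookup_sum lookup_single when_def in_keys_iff)

text \<open>
  For \<open>P\<close> the condition of having the least weight that occurs in \<open>p\<close>, the summand \<open>g\<close> is the
  initial form of \<open>p\<close>.
\<close>

lemma split_support:
  fixes p :: "'a \<Rightarrow>\<^sub>0 'b::comm_monoid_add"
  obtains g h where "p = g + h" "keys g = {a \<in> keys p. P a}" "keys h = {a \<in> keys p. \<not> P a}"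
proof -
  define part where "part Q = (\<Sum>a\<in>{a \<in> keys p. Q a}. single a (lookup p a))" for Q
  have part: "lookup (part Q) a = (if Q a then lookup p a else 0)" for Q a
    by (simp add: part_def lookup_sum lookup_single when_def in_keys_iff)
  show thesis
  proof
    show "p = part P + part (\<lambda>a. \<not> P a)"
      by (rule poly_mapping_eqI) (simp add: lookup_add part)
  qed (auto simp: in_keys_iff part split: if_splits)
qed

lemma lookup_times_monomial:
  fixes p :: "'k::comm_ring_1 mpoly"
  shows "lookup (p * single u 1) (b + u) = lookup p b"
proof -
  have "p * single u 1 = (\<Sum>a\<in>keys p. single (a + u) (lookup p a))"
    by (subst sum_of_monomials[of p]) (simp add: sum_distrib_right mult_single)
  then show ?thesis
    by (simp add: lookup_sum lookup_single when_def in_keys_iff)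
qed

section \<open>The polynomial ring and its monomial ideals\<close>

lemma mpoly_ring_simps:
  "mult (mpoly_ring n) = (*)" "one (mpoly_ring n) = 1"
  "zero (mpoly_ring n) = 0" "add (mpoly_ring n) = (+)"
  by (simp_all add: mpoly_ring_def)

lemma carrier_mpoly_ring:
  "p \<in> carrier (mpoly_ring n) \<longleftrightarrow> (\<forall>m\<in>keys p. keys m \<subseteq> {1..n})"
  by (simp add: mpoly_ring_def)

lemma nat_pow_mpoly_ring: "x [^]\<^bsub>mpoly_ring n\<^esub> (m::nat) = x ^ m"
  by (induction m) (simp_all add: mpoly_ring_simps mult.commute)

lemma a_minus_mpoly_ring:
  assumes "x \<in> carrier (mpoly_ring n)"
  shows "\<ominus>\<^bsub>mpoly_ring n\<^esub> x = - (x :: 'k::comm_ring_1 mpoly)"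
proof -
  interpret cring "mpoly_ring n :: 'k mpoly ring" by (rule cring_mpoly_ring)
  have "x \<oplus>\<^bsub>mpoly_ring n\<^esub> (- x) = \<zero>\<^bsub>mpoly_ring n\<^esub>" "- x \<in> carrier (mpoly_ring n)"
    using assms by (simp_all add: mpoly_ring_simps carrier_mpoly_ring)
  then show ?thesis
    using assms by (metis a_comm minus_equality)
qed

lemma finsum_mpoly_ring:
  fixes f :: "'i \<Rightarrow> 'k::comm_ring_1 mpoly"
  assumes "\<And>i. i \<in> A \<Longrightarrow> f i \<in> carrier (mpoly_ring n)"
  shows "finsum (mpoly_ring n) f A = sum f A"
proof -
  interpret cring "mpoly_ring n :: 'k mpoly ring" by (rule cring_mpoly_ring)
  show ?thesis
  proof (cases "finite A")
    case True
    then show ?thesis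
      using assms
    proof (induction A rule: finite_induct)
      case (insert i A)
      then have "finsum (mpoly_ring n) f (insert i A) = f i \<oplus>\<^bsub>mpoly_ring n\<^esub> finsum (mpoly_ring n) f A"
        by (intro finsum_insert) auto
      with insert show ?case
        by (simp add: mpoly_ring_simps)
    qed (simp add: mpoly_ring_simps)
  qed (simp add: finsum_infinite mpoly_ring_simps)
qed

lemma ideal_mpoly_ring_closed:
  fixes J :: "'k::comm_ring_1 mpoly set"
  assumes "ideal J (mpoly_ring n)"
  shows "0 \<in> J" "x \<in> J \<Longrightarrow> y \<in> J \<Longrightarrow> x + y \<in> J" "x \<in> J \<Longrightarrow> - x \<in> J"
    "x \<in> J \<Longrightarrow> x \<in> carrier (mpoly_ring n)"
    "x \<in> J \<Longrightarrow> r \<in> carrier (mpoly_ring n) \<Longrightarrow> r * x \<in> J"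
    "(\<And>i. i \<in> A \<Longrightarrow> f i \<in> J) \<Longrightarrow> sum f A \<in> J"
proof -
  interpret ideal J "mpoly_ring n" by fact
  show zero: "0 \<in> J" 
    using additive_subgroup.zero_closed[OF additive_subgroup_axioms] by (simp add: mpoly_ring_simps)
  show add: "x + y \<in> J" if "x \<in> J" "y \<in> J" for x y
    using additive_subgroup.a_closed[OF additive_subgroup_axioms that] by (simp add: mpoly_ring_simps)
  show carr: "x \<in> carrier (mpoly_ring n)" if "x \<in> J" for x
    using that by (rule Icarr)
  show "- x \<in> J" if "x \<in> J"
    using additive_subgroup.a_inv_closed[OF additive_subgroup_axioms that] a_minus_mpoly_ring[OF carr[OF that]] by simp
  show "r * x \<in> J" if "x \<in> J" "r \<in> carrier (mpoly_ring n)"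
    using I_l_closed[OF that] by (simp add: mpoly_ring_simps)
  show "sum f A \<in> J" if "\<And>i. i \<in> A \<Longrightarrow> f i \<in> J"
    using that zero add by (induction A rule: infinite_finite_induct) auto
qed

definition monomial_ideal :: "nat \<Rightarrow> ((nat \<Rightarrow>\<^sub>0 nat) \<Rightarrow> bool) \<Rightarrow> 'k::comm_ring_1 mpoly set" where
  "monomial_ideal n U = {p \<in> carrier (mpoly_ring n). \<forall>a\<in>keys p. U a}"

text \<open>
  Multiplying by a polynomial only moves monomials upwards, so upward closure of \<open>U\<close> is exactly
  what makes the polynomials supported in \<open>U\<close> an ideal.
\<close>

lemma ideal_monomial_ideal:
  assumes "\<And>a b. U a \<Longrightarrow> U (a + b)"
  shows "ideal (monomial_ideal n U :: 'k::comm_ring_1 mpoly set) (mpoly_ring n)"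
proof -
  interpret R: cring "mpoly_ring n :: 'k mpoly ring" by (rule cring_mpoly_ring)
  let ?M = "monomial_ideal n U :: 'k mpoly set"
  have add: "x + y \<in> ?M" if "x \<in> ?M" "y \<in> ?M" for x y
    using that R.a_closed[of x y] Poly_Mapping.keys_add[of x y] 
    by (auto simp: monomial_ideal_def mpoly_ring_simps)
  have mult: "r * x \<in> ?M" if x: "x \<in> ?M" and r: "r \<in> carrier (mpoly_ring n)" for r x
  proof -
    have "U a" if a: "a \<in> keys (r * x)" for a
    proof -
      obtain b c where "a = c + b" "c \<in> keys x"
        using keys_mult[of r x] a by (auto simp: add.commute)
      then show ?thesis using x assms by (auto simp: monomial_ideal_def)
    qed
    then show ?thesis
      using x r R.m_closed[of r x] by (simp add: monomial_ideal_def mpoly_ring_simps)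
  qed
  have sub: "?M \<subseteq> carrier (mpoly_ring n)"
    by (auto simp: monomial_ideal_def)
  show ?thesis
  proof (rule idealI[OF R.ring_axioms])
    show "subgroup ?M (add_monoid (mpoly_ring n))"
    proof (rule group.subgroupI)
      show "inv\<^bsub>add_monoid (mpoly_ring n)\<^esub> x \<in> ?M" if x: "x \<in> ?M" for x
      proof -
        have "inv\<^bsub>add_monoid (mpoly_ring n)\<^esub> x = - x"
          using x sub a_minus_mpoly_ring[of x n] by (auto simp: a_inv_def)
        then show ?thesis
          using x by (simp add: monomial_ideal_def carrier_mpoly_ring)
      qed
      show "?M \<noteq> {}"
        using R.zero_closed by (force simp: monomial_ideal_def mpoly_ring_simps)
    qed (use sub add R.a_group in \<open>simp_all add: mpoly_ring_simps\<close>)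
    show "x \<otimes>\<^bsub>mpoly_ring n\<^esub> a \<in> ?M" "a \<otimes>\<^bsub>mpoly_ring n\<^esub> x \<in> ?M"
      if "a \<in> ?M" "x \<in> carrier (mpoly_ring n)" for a x
      using mult[OF that] by (simp_all add: mpoly_ring_simps mult.commute)
  qed
qed

section \<open>Weight orders\<close>

definition weight :: "nat set \<Rightarrow> (nat \<Rightarrow>\<^sub>0 nat) \<Rightarrow> nat" where
  "weight S a = (\<Sum>i\<in>S. lookup a i)"

lemma weight_add: "weight S (a + b) = weight S a + weight S b"
  by (simp add: weight_def lookup_add sum.distrib)

text \<open>
  For finite \<open>S\<close> this is the condition \<open>v p \<ge> c\<close> for the monomial valuation \<open>v\<close> with weight \<open>1\<close> on the variables in \<open>S\<close>
  and \<open>0\<close> on the others. Stating the inequality instead of defining \<open>v\<close> avoids assigning a value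
  to the zero polynomial, which satisfies it for every \<open>c\<close>.
\<close>

definition order_ge :: "nat set \<Rightarrow> nat \<Rightarrow> 'k::comm_ring_1 mpoly set" where
  "order_ge S c = {p. \<forall>a\<in>keys p. c \<le> weight S a}"

lemma order_ge_add: "p \<in> order_ge S c \<Longrightarrow> q \<in> order_ge S c \<Longrightarrow> p + q \<in> order_ge S c"
  using Poly_Mapping.keys_add[of p q] by (auto simp: order_ge_def)

lemma order_ge_uminus: "p \<in> order_ge S c \<Longrightarrow> - p \<in> order_ge S c"
  by (simp add: order_ge_def)

lemma order_ge_sum: "(\<And>i. i \<in> A \<Longrightarrow> f i \<in> order_ge S c) \<Longrightarrow> sum f A \<in> order_ge S c"
  by (induction A rule: infinite_finite_induct) (auto simp: order_ge_add, auto simp: order_ge_def)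

lemma order_ge_mono: "p \<in> order_ge S c \<Longrightarrow> d \<le> c \<Longrightarrow> p \<in> order_ge S d"
  by (auto simp: order_ge_def)

lemma order_ge_mult:
  assumes "p \<in> order_ge S c" "q \<in> order_ge S d"
  shows "p * q \<in> order_ge S (c + d)"
  unfolding order_ge_def
proof (intro CollectI ballI)
  fix a assume "a \<in> keys (p * q)"
  then obtain b b' where "a = b + b'" "b \<in> keys p" "b' \<in> keys q"
    using keys_mult[of p q] by blast
  then show "c + d \<le> weight S a"
    using assms by (auto simp: order_ge_def weight_add intro: add_mono)
qed

lemma order_ge_power: "p \<in> order_ge S c \<Longrightarrow> p ^ m \<in> order_ge S (m * c)"
  by (induction m) (auto simp: order_ge_mult, auto simp: order_ge_def)

text \<open>
  This is the multiplicativity \<open>v (p * q) = v p + v q\<close> of the valuation, the other inequality being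
  \<open>order_ge_mult\<close>. Modulo terms of higher weight, the product of \<open>p\<close> and \<open>q\<close> is the product of their
  initial forms \<open>p0\<close> and \<open>q0\<close>, which is nonzero because polynomials over a domain form a domain,
  and which is homogeneous of weight \<open>c + d\<close>.
\<close>

lemma order_ge_mult_exact:
  fixes p q :: "'k::idom mpoly"
  assumes p: "p \<in> order_ge S c" "p \<notin> order_ge S (Suc c)"
    and q: "q \<in> order_ge S d" "q \<notin> order_ge S (Suc d)"
  shows "p * q \<notin> order_ge S (Suc (c + d))"
proof
  assume pq: "p * q \<in> order_ge S (Suc (c + d))"
  have split: "\<exists>r0 r1. r = r0 + r1 \<and> r0 \<noteq> 0 \<and> (\<forall>a\<in>keys r0. weight S a = e) \<and> r1 \<in> order_ge S (Suc e)"
    if r: "r \<in> order_ge S e" "r \<notin> order_ge S (Suc e)" for r :: "'k mpoly" and e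
  proof -
    obtain r0 r1 where r01: "r = r0 + r1" "keys r0 = {a \<in> keys r. weight S a = e}"
      "keys r1 = {a \<in> keys r. weight S a \<noteq> e}"
      by (rule split_support)
    have "r1 \<in> order_ge S (Suc e)"
      using r(1) r01(3) by (force simp: order_ge_def)
    moreover from this have "r0 \<noteq> 0"
      using r(2) r01(1) by auto
    ultimately show ?thesis
      using r01 by blast
  qed
  obtain p0 p1 where p0: "p = p0 + p1" "p0 \<noteq> 0" "\<forall>a\<in>keys p0. weight S a = c"
    "p1 \<in> order_ge S (Suc c)"
    using split[OF p] by blast
  obtain q0 q1 where q0: "q = q0 + q1" "q0 \<noteq> 0" "\<forall>a\<in>keys q0. weight S a = d"
    "q1 \<in> order_ge S (Suc d)"
    using split[OF q] by blast
  have "p0 \<in> order_ge S c"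
    using p0(3) by (simp add: order_ge_def)
  have "p0 * q1 \<in> order_ge S (Suc (c + d))" "p1 * q \<in> order_ge S (Suc (c + d))"
    using order_ge_mult[OF \<open>p0 \<in> order_ge S c\<close> q0(4)] order_ge_mult[OF p0(4) q(1)] by simp_all
  then have "p * q + - (p0 * q1 + p1 * q) \<in> order_ge S (Suc (c + d))"
    using pq order_ge_add order_ge_uminus by blast
  then have low: "p0 * q0 \<in> order_ge S (Suc (c + d))"
    by (simp add: p0(1) q0(1) algebra_simps)
  have "p0 * q0 \<noteq> 0"
    using p0(2) q0(2) by simp
  then obtain a where a: "a \<in> keys (p0 * q0)"
    by (metis keys_eq_empty all_not_in_conv)
  then obtain b b' where "a = b + b'" "b \<in> keys p0" "b' \<in> keys q0"
    using keys_mult[of p0 q0] by blast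
  then have "weight S a = c + d"
    using p0(3) q0(3) by (simp add: weight_add)
  then show False
    using low a by (auto simp: order_ge_def)
qed

lemma order_ge_power_exact:
  fixes p :: "'k::idom mpoly"
  assumes "p \<in> order_ge S c" "p \<notin> order_ge S (Suc c)"
  shows "p ^ m \<notin> order_ge S (Suc (m * c))"
proof (induction m)
  case 0
  then show ?case by (simp add: order_ge_def weight_def)
next
  case (Suc m)
  then show ?case
    using order_ge_mult_exact[OF assms order_ge_power[OF assms(1), of m]] by simp
qed

section \<open>Integral equations by elimination\<close>

text \<open>
  The possible sums of the lower terms in an equation of degree \<open>d\<close> for \<open>x\<close>, where the coefficient of
  \<open>x ^ (d - j)\<close> comes from \<open>J j\<close>. For \<open>J j\<close> the \<open>j\<close>-th power of an ideal these are the equations of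
  integral dependence.
\<close>

definition lower_terms :: "(nat \<Rightarrow> 'a set) \<Rightarrow> 'a \<Rightarrow> nat \<Rightarrow> 'a::comm_ring_1 set" where
  "lower_terms J x d = {\<Sum>j\<in>{1..d}. a j * x ^ (d - j) | a. \<forall>j\<in>{1..d}. a j \<in> J j}"

locale multiplicative_filtration =
  fixes J :: "nat \<Rightarrow> 'a::idom set"
  assumes zero: "0 \<in> J i"
    and add: "a \<in> J i \<Longrightarrow> b \<in> J i \<Longrightarrow> a + b \<in> J i"
    and uminus: "a \<in> J i \<Longrightarrow> - a \<in> J i"
    and mult: "a \<in> J i \<Longrightarrow> b \<in> J j \<Longrightarrow> a * b \<in> J (i + j)"
begin

lemma lower_terms_zero: "0 \<in> lower_terms J x d"
  unfolding lower_terms_def by (rule CollectI, rule exI[of _ "\<lambda>_. 0"]) (simp add: zero)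

lemma lower_terms_add:
  assumes "y \<in> lower_terms J x d" "z \<in> lower_terms J x d"
  shows "y + z \<in> lower_terms J x d"
proof -
  obtain a b where "y = (\<Sum>j\<in>{1..d}. a j * x ^ (d - j))" "\<forall>j\<in>{1..d}. a j \<in> J j"
    "z = (\<Sum>j\<in>{1..d}. b j * x ^ (d - j))" "\<forall>j\<in>{1..d}. b j \<in> J j"
    using assms unfolding lower_terms_def by blast
  then show ?thesis
    unfolding lower_terms_def
    by (intro CollectI exI[of _ "\<lambda>j. a j + b j"]) (auto simp: sum.distrib algebra_simps add)
qed

lemma lower_terms_uminus:
  assumes "y \<in> lower_terms J x d"
  shows "- y \<in> lower_terms J x d"
proof -
  obtain a where "y = (\<Sum>j\<in>{1..d}. a j * x ^ (d - j))" "\<forall>j\<in>{1..d}. a j \<in> J j"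
    using assms unfolding lower_terms_def by blast
  then show ?thesis
    unfolding lower_terms_def
    by (intro CollectI exI[of _ "\<lambda>j. - a j"]) (auto simp: sum_negf uminus)
qed

lemma lower_terms_sum:
  "(\<And>i. i \<in> A \<Longrightarrow> f i \<in> lower_terms J x d) \<Longrightarrow> sum f A \<in> lower_terms J x d"
  by (induction A rule: infinite_finite_induct) (simp_all add: lower_terms_zero lower_terms_add)

lemma lower_terms_single:
  assumes "a \<in> J i" "i \<in> {1..d}"
  shows "a * x ^ (d - i) \<in> lower_terms J x d"
proof -
  have "(\<Sum>j\<in>{1..d}. (if j = i then a else 0) * x ^ (d - j)) = a * x ^ (d - i)"
    using assms(2) by (simp add: if_distrib[of "\<lambda>c. c * _"] cong: if_cong)
  then show ?thesis
    using assms unfolding lower_terms_def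
    by (intro CollectI exI[of _ "\<lambda>j. if j = i then a else 0"]) (auto simp: zero)
qed

lemma lower_terms_one: "a \<in> J 1 \<Longrightarrow> a \<in> lower_terms J x 1"
  using lower_terms_single[of a 1 1 x] by simp

lemma lower_terms_power:
  assumes "y \<in> lower_terms J x d"
  shows "y * x ^ e \<in> lower_terms J x (d + e)"
proof -
  obtain a where a: "y = (\<Sum>j\<in>{1..d}. a j * x ^ (d - j))" "\<forall>j\<in>{1..d}. a j \<in> J j"
    using assms unfolding lower_terms_def by blast
  have "a j * x ^ (d - j) * x ^ e \<in> lower_terms J x (d + e)" if j: "j \<in> {1..d}" for j
  proof -
    have "d - j + e = d + e - j"
      using j by simp
    then have "a j * x ^ (d - j) * x ^ e = a j * x ^ (d + e - j)"
      by (metis mult.assoc power_add)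
    moreover have "a j * x ^ (d + e - j) \<in> lower_terms J x (d + e)"
      using a(2) j by (intro lower_terms_single) auto
    ultimately show ?thesis
      by (simp only:)
  qed
  then show ?thesis
    unfolding a(1) sum_distrib_right by (rule lower_terms_sum)
qed

text \<open>
  The coefficient of \<open>x ^ (d - i)\<close> in \<open>J i\<close> times the coefficient of \<open>x ^ (e - j)\<close> in \<open>J j\<close> lies in
  \<open>J (i + j)\<close>, as the exponent \<open>d + e - (i + j)\<close> of the product demands. This homogeneity is what
  lets elimination respect the filtration.
\<close>

lemma lower_terms_mult:
  assumes "y \<in> lower_terms J x d" "z \<in> lower_terms J x e"
  shows "y * z \<in> lower_terms J x (d + e)"
proof -
  obtain a b where ab: "y = (\<Sum>j\<in>{1..d}. a j * x ^ (d - j))" "\<forall>j\<in>{1..d}. a j \<in> J j"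
    "z = (\<Sum>j\<in>{1..e}. b j * x ^ (e - j))" "\<forall>j\<in>{1..e}. b j \<in> J j"
    using assms unfolding lower_terms_def by blast
  have "(a i * x ^ (d - i)) * (b j * x ^ (e - j)) \<in> lower_terms J x (d + e)"
    if ij: "i \<in> {1..d}" "j \<in> {1..e}" for i j
  proof -
    have "(d - i) + (e - j) = d + e - (i + j)"
      using ij by simp
    then have "(a i * x ^ (d - i)) * (b j * x ^ (e - j)) = (a i * b j) * x ^ (d + e - (i + j))"
      by (metis mult.assoc mult.left_commute power_add)
    moreover have "(a i * b j) * x ^ (d + e - (i + j)) \<in> lower_terms J x (d + e)"
      using ab ij by (intro lower_terms_single mult) auto
    ultimately show ?thesis
      by (simp only:)
  qed
  then show ?thesis
    unfolding ab(1,3) sum_product by (intro lower_terms_sum)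
qed

text \<open>
  Substitute for the determinant in the proof that an element acting on a finitely generated module
  through a matrix over \<open>J 1\<close> is integral. Call \<open>x ^ d\<close> plus lower terms monic of degree \<open>d\<close>. The
  hypothesis is a square homogeneous system with monic diagonal entries and lower terms elsewhere.
  Cross-multiplying with the row of \<open>k\<close> eliminates the unknown \<open>v k\<close>, and the smaller system has
  the same shape in degree \<open>d + d\<close>. In the end a single monic entry annihilates a nonzero element
  of a domain, so this entry vanishes, which is the desired equation.
\<close>

lemma integral_equation_by_elimination:
  assumes "finite K" "K \<noteq> {}" "1 \<le> d"
    and "\<And>i. i \<in> K \<Longrightarrow> v i \<noteq> 0"
    and "\<And>i. i \<in> K \<Longrightarrow> (\<Sum>j\<in>K. B i j * v j) = 0"
    and "\<And>i. i \<in> K \<Longrightarrow> B i i - x ^ d \<in> lower_terms J x d"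
    and "\<And>i j. i \<in> K \<Longrightarrow> j \<in> K \<Longrightarrow> i \<noteq> j \<Longrightarrow> B i j \<in> lower_terms J x d"
  shows "\<exists>m\<ge>1. \<exists>q\<in>lower_terms J x m. x ^ m + q = 0"
  using assms
proof (induction K arbitrary: B d rule: finite_ne_induct)
  case (singleton i)
  then have "B i i = 0"
    by auto
  then have "x ^ d + (B i i - x ^ d) = 0"
    by simp
  then show ?case
    using singleton.prems by blast
next
  case (insert k K)
  define B' where "B' i j = B k k * B i j - B i k * B k j" for i j
  have rel: "(\<Sum>j\<in>K. B i j * v j) = - (B i k * v k)" if "i \<in> insert k K" for i
    using insert.prems(3)[OF that] insert.hyps by (simp add: eq_neg_iff_add_eq_0 add.commute)
  show ?case
  proof (rule insert.IH[of "d + d" B'])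
    show "(\<Sum>j\<in>K. B' i j * v j) = 0" if "i \<in> K" for i
    proof -
      have "(\<Sum>j\<in>K. B' i j * v j) = B k k * (\<Sum>j\<in>K. B i j * v j) - B i k * (\<Sum>j\<in>K. B k j * v j)"
        by (simp add: B'_def sum_distrib_left sum_subtractf algebra_simps)
      then show ?thesis
        using rel that by simp
    qed
    show "B' i i - x ^ (d + d) \<in> lower_terms J x (d + d)" if i: "i \<in> K" for i
    proof -
      define l l' where "l = B k k - x ^ d" and "l' = B i i - x ^ d"
      have l: "l \<in> lower_terms J x d" "l' \<in> lower_terms J x d"
        "B i k \<in> lower_terms J x d" "B k i \<in> lower_terms J x d"
        using insert.prems(4,5) i insert.hyps by (auto simp: l_def l'_def)
      have "B' i i - x ^ (d + d) = l' * x ^ d + l * x ^ d + l * l' + - (B i k * B k i)"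
        by (simp add: B'_def l_def l'_def algebra_simps power_add)
      then show ?thesis
        using l by (simp only:)
          (intro lower_terms_add lower_terms_uminus lower_terms_mult lower_terms_power)
    qed
    show "B' i j \<in> lower_terms J x (d + d)" if ij: "i \<in> K" "j \<in> K" "i \<noteq> j" for i j
    proof -
      define l where "l = B k k - x ^ d"
      have l: "l \<in> lower_terms J x d" "B i j \<in> lower_terms J x d"
        "B i k \<in> lower_terms J x d" "B k j \<in> lower_terms J x d"
        using insert.prems(4,5) ij insert.hyps by (auto simp: l_def)
      have "B' i j = B i j * x ^ d + l * B i j + - (B i k * B k j)"
        by (simp add: B'_def l_def algebra_simps)
      then show ?thesis
        using l by (simp only:)
          (intro lower_terms_add lower_terms_uminus lower_terms_mult lower_terms_power)
    qed
  qed (use insert.prems in auto)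
qed

end

section \<open>Integral closure in the polynomial ring\<close>

lemma ideal_ideals_set_power:
  assumes "cring R" "ideal I R"
  shows "ideal (I [^]\<^bsub>ideals_set R\<^esub> (j::nat)) R"
proof -
  interpret comm_monoid "ideals_set R"
    using assms(1) by (rule cring.ideals_set_is_comm_monoid)
  show ?thesis
    using nat_pow_closed[of I j] assms(2) by (simp add: ideals_set_def)
qed

lemma filtration_ideal_powers:
  fixes I :: "'k::field mpoly set"
  assumes I: "ideal I (mpoly_ring n)"
  shows "multiplicative_filtration (\<lambda>j. I [^]\<^bsub>ideals_set (mpoly_ring n)\<^esub> j)"
proof -
  interpret M: comm_monoid "ideals_set (mpoly_ring n :: 'k mpoly ring)"
    using cring_mpoly_ring by (rule cring.ideals_set_is_comm_monoid)
  note ideal = ideal_mpoly_ring_closed[OF ideal_ideals_set_power[OF cring_mpoly_ring I]]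
  show ?thesis
  proof
    fix i j :: nat and a b :: "'k mpoly"
    assume ab: "a \<in> I [^]\<^bsub>ideals_set (mpoly_ring n)\<^esub> i" "b \<in> I [^]\<^bsub>ideals_set (mpoly_ring n)\<^esub> j"
    have "I [^]\<^bsub>ideals_set (mpoly_ring n)\<^esub> (i + j) =
      ideal_prod (mpoly_ring n) (I [^]\<^bsub>ideals_set (mpoly_ring n)\<^esub> i) (I [^]\<^bsub>ideals_set (mpoly_ring n)\<^esub> j)"
      using M.nat_pow_mult[of I i j] I by (simp add: ideals_set_def)
    then show "a * b \<in> I [^]\<^bsub>ideals_set (mpoly_ring n)\<^esub> (i + j)"
      using ideal_prod.prod[OF ab, of "mpoly_ring n"] by (simp add: mpoly_ring_simps)
  qed (use ideal in auto)
qed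

lemma integral_closure_iff:
  fixes I :: "'k::field mpoly set"
  assumes I: "ideal I (mpoly_ring n)"
  shows "r \<in> integral_closure (mpoly_ring n) I \<longleftrightarrow>
    r \<in> carrier (mpoly_ring n) \<and>
    (\<exists>m\<ge>1. \<exists>q\<in>lower_terms (\<lambda>j. I [^]\<^bsub>ideals_set (mpoly_ring n)\<^esub> j) r m. r ^ m + q = 0)"
proof (cases "r \<in> carrier (mpoly_ring n)")
  case True
  interpret R: cring "mpoly_ring n :: 'k mpoly ring" by (rule cring_mpoly_ring)
  have carr: "a j * r ^ (m - j) \<in> carrier (mpoly_ring n)"
    if "\<forall>j\<in>{1..m}. a j \<in> I [^]\<^bsub>ideals_set (mpoly_ring n)\<^esub> j" "j \<in> {1..m}" for a m j
  proof -
    have "a j \<in> carrier (mpoly_ring n)"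
      using ideal_mpoly_ring_closed(4)[OF ideal_ideals_set_power[OF cring_mpoly_ring I]] that
      by blast
    then show ?thesis
      using R.m_closed[of "a j" "r ^ (m - j)"] R.nat_pow_closed[OF True, of "m - j"]
      by (simp add: mpoly_ring_simps nat_pow_mpoly_ring)
  qed
  have "(\<Oplus>\<^bsub>mpoly_ring n\<^esub>j \<in> {1..m}. a j * r ^ (m - j)) = (\<Sum>j\<in>{1..m}. a j * r ^ (m - j))"
    if "\<forall>j\<in>{1..m}. a j \<in> I [^]\<^bsub>ideals_set (mpoly_ring n)\<^esub> j" for a m
    using carr[OF that] by (rule finsum_mpoly_ring)
  then show ?thesis
    using True unfolding integral_closure_def lower_terms_def mpoly_ring_simps nat_pow_mpoly_ring
    by (simp cong: conj_cong) blast
qed (simp add: integral_closure_def)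

lemma ideal_power_order_ge:
  fixes I :: "'k::field mpoly set"
  assumes "I \<subseteq> order_ge S c"
  shows "I [^]\<^bsub>ideals_set (mpoly_ring n)\<^esub> (j::nat) \<subseteq> order_ge S (j * c)"
proof (induction j)
  case 0
  then show ?case by (auto simp: order_ge_def)
next
  case (Suc j)
  have "x \<in> order_ge S (Suc j * c)"
    if "x \<in> ideal_prod (mpoly_ring n) (I [^]\<^bsub>ideals_set (mpoly_ring n)\<^esub> j) I" for x
    using that
  proof (induction x rule: ideal_prod.induct)
    case (prod a b)
    then have "a * b \<in> order_ge S (j * c + c)"
      using Suc.IH assms by (intro order_ge_mult) auto
    then show ?case
      by (simp add: mpoly_ring_simps add.commute)
  next
    case (sum a b)
    then show ?case
      by (simp add: mpoly_ring_simps order_ge_add)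
  qed
  then show ?case
    by (auto simp: ideals_set_def)
qed

text \<open>
  Suppose \<open>r\<close> had value \<open>v < c\<close>. In an equation of integral dependence \<open>r ^ m\<close> has value \<open>m * v\<close>,
  whereas the term \<open>a j * r ^ (m - j)\<close> has value at least \<open>j * c + (m - j) * v\<close>, which is
  strictly larger since \<open>j \<ge> 1\<close>. So \<open>r ^ m\<close> could not be cancelled.
\<close>

lemma integral_closure_order_ge:
  fixes I :: "'k::field mpoly set"
  assumes I: "ideal I (mpoly_ring n)" and Ic: "I \<subseteq> order_ge S c"
  shows "integral_closure (mpoly_ring n) I \<subseteq> order_ge S c"
proof
  fix r assume "r \<in> integral_closure (mpoly_ring n) I"
  then obtain m a where m: "m \<ge> 1"
    and a: "\<forall>j\<in>{1..m}. a j \<in> I [^]\<^bsub>ideals_set (mpoly_ring n)\<^esub> j"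
    and eq: "r ^ m + (\<Sum>j\<in>{1..m}. a j * r ^ (m - j)) = 0"
    unfolding integral_closure_iff[OF I] lower_terms_def by blast
  show "r \<in> order_ge S c"
  proof (rule ccontr)
    assume "r \<notin> order_ge S c"
    moreover have "r \<in> order_ge S 0"
      by (simp add: order_ge_def)
    ultimately obtain v where v: "v < c" "r \<in> order_ge S v" "r \<notin> order_ge S (Suc v)"
      by (induction c) (use less_Suc_eq in blast)+
    have "a j * r ^ (m - j) \<in> order_ge S (Suc (m * v))" if j: "j \<in> {1..m}" for j
    proof (rule order_ge_mono)
      have "a j \<in> order_ge S (j * c)"
        using a j ideal_power_order_ge[OF Ic] by blast
      then show "a j * r ^ (m - j) \<in> order_ge S (j * c + (m - j) * v)"
        using v(2) by (intro order_ge_mult order_ge_power)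
      have "Suc (m * v) \<le> Suc (j * v + (m - j) * v)"
        using j by (simp flip: distrib_right)
      also have "\<dots> \<le> j * Suc v + (m - j) * v"
        using j by auto
      also have "\<dots> \<le> j * c + (m - j) * v"
        using v(1) by (intro add_right_mono mult_left_mono) auto
      finally show "Suc (m * v) \<le> j * c + (m - j) * v" .
    qed
    then have "- (\<Sum>j\<in>{1..m}. a j * r ^ (m - j)) \<in> order_ge S (Suc (m * v))"
      by (intro order_ge_uminus order_ge_sum)
    then have "r ^ m \<in> order_ge S (Suc (m * v))"
      using eq by (simp only: eq_neg_iff_add_eq_0[symmetric])
    then show False
      using order_ge_power_exact[OF v(2,3)] by blast
  qed
qed

text \<open>
  The hypothesis says that multiplication by \<open>p\<close> maps the span of the monomials in \<open>C\<close> into \<open>I\<close> times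
  that span, so that \<open>p\<close> acts on it as a matrix \<open>T\<close> over \<open>I\<close>. Elimination applies to the system with
  matrix \<open>p - T\<close>, which annihilates the vector of the monomials in \<open>C\<close>.
\<close>

lemma integral_of_monomial_translates:
  fixes I :: "'k::field mpoly set"
  assumes I: "ideal I (mpoly_ring n)" and p: "p \<in> carrier (mpoly_ring n)"
    and C: "finite C" "C \<noteq> {}"
    and step: "\<And>a c. a \<in> keys p \<Longrightarrow> c \<in> C \<Longrightarrow>
      \<exists>c'\<in>C. \<exists>u. single u 1 \<in> I \<and> a + c = u + c'"
  shows "p \<in> integral_closure (mpoly_ring n) I"
proof -
  let ?J = "\<lambda>j::nat. I [^]\<^bsub>ideals_set (mpoly_ring n)\<^esub> j"
  interpret multiplicative_filtration ?J
    using I by (rule filtration_ideal_powers)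
  interpret M: comm_monoid "ideals_set (mpoly_ring n :: 'k mpoly ring)"
    using cring_mpoly_ring by (rule cring.ideals_set_is_comm_monoid)
  have J1: "?J 1 = I"
    using M.nat_pow_Suc[of I 0] M.l_one[of I] I by (simp add: ideals_set_def)
  obtain f u where f: "\<And>a c. a \<in> keys p \<Longrightarrow> c \<in> C \<Longrightarrow>
      f a c \<in> C \<and> single (u a c) (1::'k) \<in> I \<and> a + c = u a c + f a c"
    using step by metis
  define T where "T c c' = (\<Sum>a\<in>{a \<in> keys p. f a c = c'}. single (u a c) (lookup p a))" for c c'
  have T: "T c c' \<in> I" if "c \<in> C" for c c'
    unfolding T_def
  proof (rule ideal_mpoly_ring_closed(6)[OF I])
    fix a assume "a \<in> {a \<in> keys p. f a c = c'}"
    then have "single (u a c) 1 \<in> I"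
      using f that by blast
    moreover have "single 0 (lookup p a) \<in> carrier (mpoly_ring n)"
      by (simp add: carrier_mpoly_ring)
    ultimately show "single (u a c) (lookup p a) \<in> I"
      using ideal_mpoly_ring_closed(5)[OF I, of "single (u a c) 1" "single 0 (lookup p a)"]
      by (simp add: mult_single)
  qed
  have rel: "p * single c 1 = (\<Sum>c'\<in>C. T c c' * single c' 1)" if c: "c \<in> C" for c
  proof -
    have "p * single c 1 = (\<Sum>a\<in>keys p. single (a + c) (lookup p a))"
      by (subst sum_of_monomials[of p]) (simp add: sum_distrib_right mult_single)
    also have "\<dots> = (\<Sum>a\<in>keys p. single (u a c + f a c) (lookup p a))"
      using f c by (intro sum.cong) auto
    also have "\<dots> = (\<Sum>c'\<in>C. \<Sum>a\<in>{a \<in> keys p. f a c = c'}. single (u a c + f a c) (lookup p a))"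
      using C(1) f c by (intro sum.group[symmetric]) auto
    also have "\<dots> = (\<Sum>c'\<in>C. T c c' * single c' 1)"
      by (simp add: T_def sum_distrib_right mult_single)
    finally show ?thesis .
  qed
  define B where "B c c' = (if c = c' then p else 0) - T c c'" for c c'
  have "\<exists>m\<ge>1. \<exists>q\<in>lower_terms ?J p m. p ^ m + q = 0"
  proof (rule integral_equation_by_elimination[OF C, where B = B and d = 1 and v = "\<lambda>c. single c 1"])
    show "(\<Sum>c'\<in>C. B c c' * single c' 1) = 0" if "c \<in> C" for c
      using C(1) rel that
      by (simp add: B_def left_diff_distrib sum_subtractf if_distrib[of "\<lambda>y. y * _"] cong: if_cong)
    show "B c c - p ^ 1 \<in> lower_terms ?J p 1" if "c \<in> C" for c
      using lower_terms_uminus[OF lower_terms_one, of "T c c" p] T[OF that] J1 by (simp add: B_def)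
    show "B c c' \<in> lower_terms ?J p 1" if "c \<in> C" "c' \<in> C" "c \<noteq> c'" for c c'
      using lower_terms_uminus[OF lower_terms_one, of "T c c'" p] T[OF that(1)] J1 that
      by (simp add: B_def)
  qed (simp_all flip: keys_eq_empty)
  then show ?thesis
    using p by (simp add: integral_closure_iff[OF I])
qed

section \<open>The integral closure of $I_{n,t}$\<close>

definition deficit :: "nat \<Rightarrow> nat \<Rightarrow> (nat \<Rightarrow>\<^sub>0 nat) \<Rightarrow> nat" where
  "deficit n t a = (\<Sum>i\<in>{1..n}. t - lookup a i)"

lemma deficit_add_le: "deficit n t (a + b) \<le> deficit n t a"
  by (auto simp: deficit_def lookup_add intro: sum_mono)

lemma I_nt_eq:
  "I_nt n t = Idl\<^bsub>mpoly_ring n\<^esub> ((\<lambda>i. single (exponent ({1..n} - {i}) (\<lambda>_. t)) (1::'k::comm_ring_1)) ` {1..n})"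
proof -
  have pow: "mpoly_var j ^ t = single (single j t) (1::'k)" for j t
    by (induction t) (simp_all add: mpoly_var_def mult_single single_add[symmetric])
  have "(\<Prod>j\<in>A. mpoly_var j ^ t) = single (exponent A (\<lambda>_. t)) (1::'k)" if "finite A" for A
    using that by induction (simp_all add: pow exponent_def mult_single)
  then show ?thesis
    unfolding I_nt_def Setcompr_eq_image by simp
qed

lemma generator_in_carrier:
  "single (exponent ({1..n} - {i}) g) 1 \<in> carrier (mpoly_ring n :: 'k::comm_ring_1 mpoly ring)"
  using keys_exponent[of "{1..n} - {i}" g] by (auto simp: carrier_mpoly_ring)

lemma ideal_I_nt: "ideal (I_nt n t :: 'k::comm_ring_1 mpoly set) (mpoly_ring n)"
proof -
  interpret cring "mpoly_ring n :: 'k mpoly ring" by (rule cring_mpoly_ring)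
  show ?thesis
    unfolding I_nt_eq using generator_in_carrier by (intro genideal_ideal) blast
qed

text \<open>
  The generator that omits \<open>x\<^sub>i\<close> has degree \<open>t\<close> in every variable of \<open>S\<close> except possibly \<open>x\<^sub>i\<close>.
\<close>

lemma I_nt_order_ge:
  assumes S: "S \<subseteq> {1..n}"
  shows "(I_nt n t :: 'k::comm_ring_1 mpoly set) \<subseteq> order_ge S ((card S - 1) * t)"
proof -
  interpret cring "mpoly_ring n :: 'k mpoly ring" by (rule cring_mpoly_ring)
  let ?M = "monomial_ideal n (\<lambda>a. (card S - 1) * t \<le> weight S a) :: 'k mpoly set"
  have fin: "finite S" using S finite_subset by blast
  have "single (exponent ({1..n} - {i}) (\<lambda>_. t)) 1 \<in> ?M" for i
  proof -
    have "weight S (exponent ({1..n} - {i}) (\<lambda>_. t)) = (\<Sum>j\<in>S - {i}. t)"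
      unfolding weight_def using S fin
      by (intro sum.mono_neutral_cong_right) (auto simp: lookup_exponent)
    then have "(card S - 1) * t \<le> weight S (exponent ({1..n} - {i}) (\<lambda>_. t))"
      using fin by (simp add: card_Diff_singleton_if)
    then show ?thesis
      using generator_in_carrier by (auto simp: monomial_ideal_def)
  qed
  then have "I_nt n t \<subseteq> ?M"
    unfolding I_nt_eq by (intro genideal_minimal ideal_monomial_ideal) (auto simp: weight_add)
  then show ?thesis
    by (auto simp: monomial_ideal_def order_ge_def)
qed

lemma finite_bounded_exponents: "finite {c. keys c \<subseteq> {1..n::nat} \<and> (\<forall>i. lookup c i \<le> (b::nat))}"
proof (rule finite_imageD)
  have "lookup ` {c. keys c \<subseteq> {1..n::nat} \<and> (\<forall>i. lookup c i \<le> b)} \<subseteq>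
    {f. \<forall>x. (x \<in> {1..n} \<longrightarrow> f x \<in> {..b}) \<and> (x \<notin> {1..n} \<longrightarrow> f x = 0)}"
    by (auto simp: in_keys_iff subset_iff)
  then show "finite (lookup ` {c. keys c \<subseteq> {1..n::nat} \<and> (\<forall>i. lookup c i \<le> b)})"
    by (rule finite_subset) (rule finite_set_of_finite_funs[OF finite_atLeastAtMost finite_atMost])
qed (simp add: inj_on_def)

text \<open>
  The monomials \<open>c\<close> of deficit at most \<open>n * t\<close> with respect to the level \<open>n * t\<close> are the lattice points
  of the \<open>n\<close>-fold dilate of the Newton polyhedron. The product of such a monomial with \<open>x\<^sup>a\<close> lies in
  the \<open>(n + 1)\<close>-fold dilate, and the claim is that a generator can be split off without leaving the
  \<open>n\<close>-fold dilate. The generator to split off omits the variable \<open>x\<^sub>i\<close> with the largest deficit \<open>d i\<close>: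
  this keeps the other deficits and lowers \<open>d i\<close> by \<open>t\<close>. If \<open>d i \<ge> t\<close>, the total drops by \<open>t\<close>, as
  required. Otherwise every deficit is below \<open>t\<close>, and the remaining \<open>n - 1\<close> of them sum to at most
  \<open>n * t\<close>; this is why the dilation factor \<open>n\<close> is large enough. Exponents above \<open>n * t\<close> do not
  affect the deficit and are cut down to \<open>n * t\<close>, which leaves only finitely many monomials.
\<close>

lemma exponent_translate:
  assumes n: "n \<ge> 1"
    and a: "keys a \<subseteq> {1..n}" "deficit n t a \<le> t"
    and c: "keys c \<subseteq> {1..n}" "deficit n (n * t) c \<le> n * t"
  shows "\<exists>i\<in>{1..n}. \<exists>c'. keys c' \<subseteq> {1..n} \<and> (\<forall>j. lookup c' j \<le> n * t) \<and> deficit n (n * t) c' \<le> n * t \<and>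
    (\<forall>j. lookup (exponent ({1..n} - {i}) (\<lambda>_. t)) j + lookup c' j \<le> lookup (a + c) j)"
proof -
  define x where "x = lookup (a + c)"
  define d where "d j = Suc n * t - x j" for j
  have "d j \<le> (t - lookup a j) + (n * t - lookup c j)" for j
    by (simp add: d_def x_def lookup_add)
  then have "(\<Sum>j\<in>{1..n}. d j) \<le> deficit n t a + deficit n (n * t) c"
    by (simp add: deficit_def sum_mono flip: sum.distrib)
  then have dsum: "(\<Sum>j\<in>{1..n}. d j) \<le> Suc n * t"
    using a c by simp
  have "{1..n} \<noteq> {}" using n by simp
  then obtain i where i: "i \<in> {1..n}" and di: "Max (d ` {1..n}) = d i"
    using Max_in[of "d ` {1..n}"] by blast
  have max: "d j \<le> d i" if "j \<in> {1..n}" for j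
    using that di[symmetric] by simp
  have dsplit: "(\<Sum>j\<in>{1..n}. d j) = d i + (\<Sum>j\<in>{1..n} - {i}. d j)"
    using i by (simp add: sum.remove)
  \<comment> \<open>Two deficits sum to at most \<open>(n + 1) * t\<close>, so one that is not the largest is at most half of
    that, which is at most \<open>n * t\<close> because \<open>n \<ge> 1\<close>.\<close>
  have dj: "d j \<le> n * t" if j: "j \<in> {1..n} - {i}" for j
  proof -
    have "d j \<le> (\<Sum>j\<in>{1..n} - {i}. d j)"
      using j by (intro member_le_sum) auto
    then have "2 * d j \<le> Suc n * t"
      using max[of j] j dsplit dsum by simp
    also have "\<dots> \<le> 2 * (n * t)"
      using n mult_le_mono1[of 1 n t] by simp
    finally show ?thesis by simp
  qed
  have xj: "t \<le> x j" if "j \<in> {1..n} - {i}" for j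
    using dj[OF that] by (simp add: d_def)
  define g where "g j = (if j = i then x j else x j - t)" for j
  define c' where "c' = exponent {1..n} (\<lambda>j. min (n * t) (g j))"
  have lc': "lookup c' j = (if j \<in> {1..n} then min (n * t) (g j) else 0)" for j
    by (simp add: c'_def lookup_exponent)
  have "deficit n (n * t) c' = (n * t - x i) + (\<Sum>j\<in>{1..n} - {i}. n * t - lookup c' j)"
    unfolding deficit_def using i by (simp add: sum.remove[of _ i] lc' g_def)
  also have "(\<Sum>j\<in>{1..n} - {i}. n * t - lookup c' j) = (\<Sum>j\<in>{1..n} - {i}. d j)"
  proof (rule sum.cong[OF refl])
    fix j assume "j \<in> {1..n} - {i}"
    with xj[OF this] show "n * t - lookup c' j = d j"
      by (auto simp: lc' g_def d_def min_def)
  qed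
  also have "n * t - x i = d i - t"
    by (simp add: d_def)
  finally have def: "deficit n (n * t) c' = (d i - t) + (\<Sum>j\<in>{1..n} - {i}. d j)" .
  have "deficit n (n * t) c' \<le> n * t"
  proof (cases "t \<le> d i")
    case True
    then show ?thesis using def dsplit dsum by simp
  next
    case False
    have "(\<Sum>j\<in>{1..n} - {i}. d j) \<le> (\<Sum>j\<in>{1..n} - {i}. t)"
      using max False by (intro sum_mono) (meson DiffD1 le_trans nat_le_linear)
    also have "\<dots> \<le> n * t"
      using i by (simp add: card_Diff_singleton_if)
    finally show ?thesis using def False by simp
  qed
  moreover have "lookup (exponent ({1..n} - {i}) (\<lambda>_. t)) j + lookup c' j \<le> lookup (a + c) j" for j
    using xj[of j] by (auto simp: lookup_exponent lc' g_def x_def)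
  moreover have "keys c' \<subseteq> {1..n}" "\<forall>j. lookup c' j \<le> n * t"
    by (auto simp: lc' in_keys_iff split: if_splits)
  ultimately show ?thesis
    using i by blast
qed

lemma integral_closure_I_nt:
  assumes n: "n \<ge> 1"
  shows "integral_closure (mpoly_ring n) (I_nt n t) =
    (monomial_ideal n (\<lambda>a. deficit n t a \<le> t) :: 'k::field mpoly set)"
proof (intro equalityI subsetI)
  fix r :: "'k mpoly" assume r: "r \<in> integral_closure (mpoly_ring n) (I_nt n t)"
  have "deficit n t a \<le> t" if a: "a \<in> keys r" for a
  proof -
    \<comment> \<open>The deficit of \<open>a\<close> is \<open>card S * t - weight S a\<close> for precisely this choice of \<open>S\<close>.\<close>
    define S where "S = {i \<in> {1..n}. lookup a i < t}"
    have "S \<subseteq> {1..n}" by (auto simp: S_def)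
    then have "r \<in> order_ge S ((card S - 1) * t)"
      using integral_closure_order_ge[OF ideal_I_nt I_nt_order_ge] r by blast
    then have w: "(card S - 1) * t \<le> weight S a"
      using a by (simp add: order_ge_def)
    have "deficit n t a = (\<Sum>i\<in>S. t - lookup a i)"
      unfolding deficit_def by (rule sum.mono_neutral_right) (auto simp: S_def)
    moreover have "(\<Sum>i\<in>S. t - lookup a i) + weight S a = (\<Sum>i\<in>S. t)"
      unfolding weight_def sum.distrib[symmetric] by (rule sum.cong) (auto simp: S_def)
    ultimately have "deficit n t a + weight S a = card S * t"
      by simp
    then show ?thesis
      using w by (cases "card S") auto
  qed
  then show "r \<in> monomial_ideal n (\<lambda>a. deficit n t a \<le> t)"
    using r by (auto simp: monomial_ideal_def integral_closure_def)
next
  interpret R: cring "mpoly_ring n :: 'k mpoly ring" by (rule cring_mpoly_ring)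
  fix p :: "'k mpoly" assume p: "p \<in> monomial_ideal n (\<lambda>a. deficit n t a \<le> t)"
  \<comment> \<open>The lattice points of the \<open>n\<close>-fold dilate of the Newton polyhedron, cut off at exponent \<open>n * t\<close>.\<close>
  define C where "C = {c. keys c \<subseteq> {1..n} \<and> (\<forall>i. lookup c i \<le> n * t)} \<inter>
    {c. deficit n (n * t) c \<le> n * t}"
  have gens: "single (exponent ({1..n} - {i}) (\<lambda>_. t)) (1::'k) \<in> I_nt n t" if "i \<in> {1..n}" for i
    unfolding I_nt_eq by (rule subsetD[OF R.genideal_self]) (use generator_in_carrier that in blast)+
  show "p \<in> integral_closure (mpoly_ring n) (I_nt n t)"
  proof (rule integral_of_monomial_translates[OF ideal_I_nt])
    show "finite C"
      unfolding C_def using finite_bounded_exponents by blast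
    have "deficit n (n * t) (exponent {1..n} (\<lambda>_. n * t)) = 0"
      by (simp add: deficit_def lookup_exponent)
    then have "exponent {1..n} (\<lambda>_. n * t) \<in> C"
      by (auto simp: C_def lookup_exponent in_keys_iff split: if_splits)
    then show "C \<noteq> {}" by blast
    fix a c assume a: "a \<in> keys p" and c: "c \<in> C"
    obtain i c' where i: "i \<in> {1..n}" and c': "c' \<in> C" and
      le: "\<forall>j. lookup (exponent ({1..n} - {i}) (\<lambda>_. t)) j + lookup c' j \<le> lookup (a + c) j"
      using exponent_translate[OF n, of a t c] a c p
      unfolding C_def monomial_ideal_def carrier_mpoly_ring by blast
    define u where "u = a + c - c'"
    define w where "w = u - exponent ({1..n} - {i}) (\<lambda>_. t)"
    have u: "a + c = u + c'"
    proof (rule poly_mapping_eqI)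
      fix k show "lookup (a + c) k = lookup (u + c') k"
        using le[rule_format, of k] by (simp add: u_def lookup_add lookup_minus)
    qed
    have w: "u = w + exponent ({1..n} - {i}) (\<lambda>_. t)"
    proof (rule poly_mapping_eqI)
      fix k show "lookup u k = lookup (w + exponent ({1..n} - {i}) (\<lambda>_. t)) k"
        using le[rule_format, of k] by (simp add: w_def u_def lookup_add lookup_minus)
    qed
    have "keys u \<subseteq> {1..n}"
    proof
      fix k assume "k \<in> keys u"
      then have "k \<in> keys a \<or> k \<in> keys c"
        by (auto simp: u_def in_keys_iff lookup_minus lookup_add)
      then show "k \<in> {1..n}"
        using a c p unfolding C_def monomial_ideal_def carrier_mpoly_ring by blast
    qed
    then have "single w (1::'k) \<in> carrier (mpoly_ring n)"
      by (auto simp: w_def carrier_mpoly_ring in_keys_iff lookup_minus)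
    then have "single w 1 * single (exponent ({1..n} - {i}) (\<lambda>_. t)) 1 \<in> (I_nt n t :: 'k mpoly set)"
      using gens[OF i] by (intro ideal_mpoly_ring_closed(5)[OF ideal_I_nt])
    then have "single u (1::'k) \<in> I_nt n t"
      by (simp add: mult_single w)
    then show "\<exists>c'\<in>C. \<exists>u. single u (1::'k) \<in> I_nt n t \<and> a + c = u + c'"
      using u c' by blast
  qed (use p in \<open>simp add: monomial_ideal_def\<close>)
qed

section \<open>Associated primes\<close>

lemma monomial_prime_eq_genideal:
  assumes B: "B \<subseteq> {1..n}"
  shows "Idl\<^bsub>mpoly_ring n\<^esub> (mpoly_var ` B) =
    (monomial_ideal n (\<lambda>a. 1 \<le> weight B a) :: 'k::comm_ring_1 mpoly set)"
proof
  interpret R: cring "mpoly_ring n :: 'k mpoly ring" by (rule cring_mpoly_ring)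
  have fin: "finite B" using B finite_subset by blast
  have var: "mpoly_var ` B \<subseteq> (monomial_ideal n (\<lambda>a. 1 \<le> weight B a) :: 'k mpoly set)"
    using B fin by (auto simp: mpoly_var_def monomial_ideal_def carrier_mpoly_ring weight_def
        lookup_single when_def)
  then show "Idl\<^bsub>mpoly_ring n\<^esub> (mpoly_var ` B) \<subseteq> (monomial_ideal n (\<lambda>a. 1 \<le> weight B a) :: 'k mpoly set)"
    by (intro R.genideal_minimal ideal_monomial_ideal) (auto simp: weight_add)
  have carr: "mpoly_var ` B \<subseteq> carrier (mpoly_ring n :: 'k mpoly ring)"
    using var by (auto simp: monomial_ideal_def)
  have ideal: "ideal (Idl\<^bsub>mpoly_ring n\<^esub> (mpoly_var ` B)) (mpoly_ring n :: 'k mpoly ring)"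
    using carr by (rule R.genideal_ideal)
  show "(monomial_ideal n (\<lambda>a. 1 \<le> weight B a) :: 'k mpoly set) \<subseteq> Idl\<^bsub>mpoly_ring n\<^esub> (mpoly_var ` B)"
  proof
    fix p :: "'k mpoly" assume p: "p \<in> monomial_ideal n (\<lambda>a. 1 \<le> weight B a)"
    have "single a (lookup p a) \<in> Idl\<^bsub>mpoly_ring n\<^esub> (mpoly_var ` B)" if a: "a \<in> keys p" for a
    proof -
      have "1 \<le> weight B a" using a p by (simp add: monomial_ideal_def)
      then obtain i where i: "i \<in> B" "lookup a i \<noteq> 0"
        by (metis weight_def not_one_le_zero sum.neutral)
      have "a = (a - single i 1) + single i 1"
        using i by (intro poly_mapping_eqI) (auto simp: lookup_add lookup_minus lookup_single when_def)
      then have "single a (lookup p a) = single (a - single i 1) (lookup p a) * mpoly_var i"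
        by (simp add: mpoly_var_def mult_single)
      moreover have "keys (a - single i 1) \<subseteq> keys a"
        by (auto simp: in_keys_iff lookup_minus)
      then have "single (a - single i 1) (lookup p a) \<in> carrier (mpoly_ring n)"
        using a p by (auto simp: monomial_ideal_def carrier_mpoly_ring)
      ultimately show ?thesis
        using i R.genideal_self[OF carr] by (auto intro: ideal_mpoly_ring_closed(5)[OF ideal])
    qed
    then show "p \<in> Idl\<^bsub>mpoly_ring n\<^esub> (mpoly_var ` B)"
      by (subst sum_of_monomials) (rule ideal_mpoly_ring_closed(6)[OF ideal])
  qed
qed

text \<open>
  Membership means positive value for the valuation attached to \<open>B\<close>, and values add up under
  multiplication.
\<close>

lemma primeideal_monomial_prime:
  "primeideal (monomial_ideal n (\<lambda>a. 1 \<le> weight B a) :: 'k::field mpoly set) (mpoly_ring n)"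
proof (rule primeidealI)
  let ?P = "monomial_ideal n (\<lambda>a. 1 \<le> weight B a) :: 'k mpoly set"
  have P: "p \<in> ?P \<longleftrightarrow> p \<in> order_ge B (Suc 0)" if "p \<in> carrier (mpoly_ring n)" for p
    using that by (simp add: monomial_ideal_def order_ge_def)
  show "ideal ?P (mpoly_ring n)"
    by (rule ideal_monomial_ideal) (simp add: weight_add)
  show "cring (mpoly_ring n :: 'k mpoly ring)"
    by (rule cring_mpoly_ring)
  have "1 \<in> carrier (mpoly_ring n :: 'k mpoly ring)" "1 \<notin> ?P"
    by (simp_all add: carrier_mpoly_ring monomial_ideal_def weight_def)
  then show "carrier (mpoly_ring n) \<noteq> ?P"
    by blast
  show "a \<in> ?P \<or> b \<in> ?P"
    if "a \<in> carrier (mpoly_ring n)" "b \<in> carrier (mpoly_ring n)" "a \<otimes>\<^bsub>mpoly_ring n\<^esub> b \<in> ?P" for a b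
  proof (rule ccontr)
    assume "\<not> (a \<in> ?P \<or> b \<in> ?P)"
    then have "a * b \<notin> order_ge B (Suc (0 + 0))"
      using that P by (intro order_ge_mult_exact) (auto simp: order_ge_def)
    then show False
      using that(3) by (auto simp: mpoly_ring_simps monomial_ideal_def order_ge_def)
  qed
qed

lemma associated_prime_colon:
  assumes "cring R" and J: "ideal J R" and u: "u \<in> carrier R"
    and prime: "primeideal P R" and P: "P = {r \<in> carrier R. r \<otimes>\<^bsub>R\<^esub> u \<in> J}"
  shows "P \<in> associated_primes R J"
proof -
  interpret R: cring R by fact
  interpret J: ideal J R by fact
  have "r \<odot>\<^bsub>quot_module R J\<^esub> (J +>\<^bsub>R\<^esub> u) = \<zero>\<^bsub>quot_module R J\<^esub> \<longleftrightarrow> r \<otimes>\<^bsub>R\<^esub> u \<in> J"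
    if r: "r \<in> carrier R" for r
  proof -
    have "r \<odot>\<^bsub>quot_module R J\<^esub> (J +>\<^bsub>R\<^esub> u) = J +>\<^bsub>R\<^esub> (r \<otimes>\<^bsub>R\<^esub> u)"
      using J.rcoset_mult_add[OF r u] by (simp add: quot_module_def FactRing_def)
    moreover have "\<zero>\<^bsub>quot_module R J\<^esub> = J"
      by (simp add: quot_module_def FactRing_def)
    moreover have "J +>\<^bsub>R\<^esub> (r \<otimes>\<^bsub>R\<^esub> u) = J \<longleftrightarrow> r \<otimes>\<^bsub>R\<^esub> u \<in> J"
      using J.rcos_const_imp_mem J.a_rcos_const R.m_closed[OF r u] by blast
    ultimately show ?thesis
      by (simp only:)
  qed
  moreover have "J +>\<^bsub>R\<^esub> u \<in> carrier (quot_module R J)"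
    using u R.a_rcosetsI[OF J.a_subset u] by (simp add: quot_module_def FactRing_def)
  ultimately show ?thesis
    using prime unfolding associated_primes_def Ass_def
    by (intro CollectI conjI bexI[of _ "J +>\<^bsub>R\<^esub> u"]) (auto simp only: P)
qed

text \<open>
  The monomial \<open>u\<close> has deficit \<open>d i\<close> in the variables of \<open>B\<close> and none in the others, hence total
  deficit \<open>t + 1\<close>. Since every \<open>d i\<close> is positive, multiplying by any variable of \<open>B\<close> lowers the total to
  \<open>t\<close>, while the other variables have no effect. So the annihilator of \<open>u\<close> modulo the integral
  closure is the prime generated by the variables in \<open>B\<close>.
\<close>

lemma associated_prime_of_deficits:
  fixes d :: "nat \<Rightarrow> nat"
  assumes n: "n \<ge> 1" and B: "B \<subseteq> {1..n}"
    and d: "\<And>i. i \<in> B \<Longrightarrow> 1 \<le> d i \<and> d i \<le> t" and sum: "(\<Sum>i\<in>B. d i) = Suc t"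
  shows "(Idl\<^bsub>mpoly_ring n\<^esub> (mpoly_var ` B) :: 'k::field mpoly set) \<in>
    associated_primes (mpoly_ring n) (integral_closure (mpoly_ring n) (I_nt n t))"
proof -
  let ?J = "monomial_ideal n (\<lambda>a. deficit n t a \<le> t) :: 'k mpoly set"
  let ?P = "monomial_ideal n (\<lambda>a. 1 \<le> weight B a) :: 'k mpoly set"
  have fin: "finite B" using B finite_subset by blast
  define u where "u = exponent {1..n} (\<lambda>i. if i \<in> B then t - d i else t)"
  have key: "deficit n t (b + u) \<le> t \<longleftrightarrow> 1 \<le> weight B b" for b
  proof -
    have "deficit n t (b + u) = (\<Sum>i\<in>B. d i - lookup b i)"
      unfolding deficit_def
    proof (rule sum.mono_neutral_cong_right)
      show "t - lookup (b + u) i = d i - lookup b i" if "i \<in> B" for i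
        using d[OF that] B that by (auto simp: u_def lookup_add lookup_exponent)
    qed (use B in \<open>auto simp: u_def lookup_add lookup_exponent\<close>)
    moreover have "(\<Sum>i\<in>B. d i - lookup b i) \<le> t \<longleftrightarrow> (\<exists>i\<in>B. lookup b i \<noteq> 0)"
    proof
      assume "(\<Sum>i\<in>B. d i - lookup b i) \<le> t"
      then have "(\<Sum>i\<in>B. d i - lookup b i) \<noteq> (\<Sum>i\<in>B. d i)"
        using sum by simp
      then show "\<exists>i\<in>B. lookup b i \<noteq> 0"
        by (metis (no_types, lifting) diff_zero sum.cong)
    next
      assume "\<exists>i\<in>B. lookup b i \<noteq> 0"
      then obtain i where "i \<in> B" "lookup b i \<noteq> 0" by blast
      moreover from this have "d i - lookup b i < d i"
        using d[of i] by auto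
      ultimately have "(\<Sum>i\<in>B. d i - lookup b i) < (\<Sum>i\<in>B. d i)"
        using fin by (intro sum_strict_mono_ex1) auto
      then show "(\<Sum>i\<in>B. d i - lookup b i) \<le> t"
        using sum by simp
    qed
    moreover have "1 \<le> weight B b \<longleftrightarrow> (\<exists>i\<in>B. lookup b i \<noteq> 0)"
      using fin by (simp add: weight_def Suc_le_eq flip: neq0_conv)
    ultimately show ?thesis by simp
  qed
  have colon: "?P = {r \<in> carrier (mpoly_ring n). r \<otimes>\<^bsub>mpoly_ring n\<^esub> single u 1 \<in> ?J}"
  proof -
    interpret R: cring "mpoly_ring n :: 'k mpoly ring" by (rule cring_mpoly_ring)
    have ucarr: "single u 1 \<in> carrier (mpoly_ring n :: 'k mpoly ring)"
      using keys_exponent[of "{1..n}"] by (auto simp: u_def carrier_mpoly_ring)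
    have "r * single u 1 \<in> ?J \<longleftrightarrow> r \<in> ?P" if r: "r \<in> carrier (mpoly_ring n)" for r
    proof -
      have "keys (r * single u 1) = (\<lambda>b. b + u) ` keys r"
      proof (intro equalityI subsetI)
        fix a assume "a \<in> keys (r * single u 1)"
        then show "a \<in> (\<lambda>b. b + u) ` keys r"
          using keys_mult[of r "single u 1"] by (auto split: if_splits)
      qed (auto simp: in_keys_iff lookup_times_monomial)
      then show ?thesis
        using r R.m_closed[OF r ucarr] key by (simp add: monomial_ideal_def mpoly_ring_simps)
    qed
    moreover have "?P \<subseteq> carrier (mpoly_ring n)"
      by (auto simp: monomial_ideal_def)
    ultimately show ?thesis
      by (auto simp: mpoly_ring_simps)
  qed
  have "ideal ?J (mpoly_ring n)"
    by (rule ideal_monomial_ideal) (rule order_trans[OF deficit_add_le])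
  moreover have "single u 1 \<in> carrier (mpoly_ring n :: 'k mpoly ring)"
    using keys_exponent[of "{1..n}"] by (auto simp: u_def carrier_mpoly_ring)
  ultimately show ?thesis
    unfolding integral_closure_I_nt[OF n] monomial_prime_eq_genideal[OF B]
    using cring_mpoly_ring primeideal_monomial_prime colon
    by (intro associated_prime_colon)
qed

theorem theorem2p4:
  fixes n t :: nat and R :: "'k::field mpoly ring"
  assumes "n \<ge> 3" and "t \<ge> 2"
  defines "R \<equiv> mpoly_ring n"
  shows "embedded_prime R (integral_closure R (I_nt n t))
           (Idl\<^bsub>R\<^esub> {mpoly_var 1, mpoly_var 2, mpoly_var 3})"
proof -
  have "Idl\<^bsub>R\<^esub> (mpoly_var ` {1, 2, 3}) \<in> associated_primes R (integral_closure R (I_nt n t))"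
    unfolding R_def
    by (rule associated_prime_of_deficits[where d = "\<lambda>i. if i = 1 then t - 1 else 1"])
      (use assms in auto)
  moreover have "Idl\<^bsub>R\<^esub> (mpoly_var ` {1, 2}) \<in> associated_primes R (integral_closure R (I_nt n t))"
    unfolding R_def
    by (rule associated_prime_of_deficits[where d = "\<lambda>i. if i = 1 then t else 1"])
      (use assms in auto)
  moreover have "Idl\<^bsub>R\<^esub> (mpoly_var ` {1, 2}) \<subset> Idl\<^bsub>R\<^esub> (mpoly_var ` {1, 2, 3})"
  proof -
    have B: "{1, 2} \<subseteq> {1..n}" "{1, 2, 3} \<subseteq> {1..n}"
      using assms by auto
    have "mpoly_var 3 \<in> Idl\<^bsub>R\<^esub> (mpoly_var ` {1, 2, 3})" "mpoly_var 3 \<notin> Idl\<^bsub>R\<^esub> (mpoly_var ` {1, 2})"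
      unfolding R_def monomial_prime_eq_genideal[OF B(1)] monomial_prime_eq_genideal[OF B(2)]
      using assms
      by (simp_all add: mpoly_var_def monomial_ideal_def carrier_mpoly_ring weight_def lookup_single)
    moreover have "Idl\<^bsub>R\<^esub> (mpoly_var ` {1, 2}) \<subseteq> Idl\<^bsub>R\<^esub> (mpoly_var ` {1, 2, 3})"
      unfolding genideal_def by blast
    ultimately show ?thesis by blast
  qed
  ultimately show ?thesis
    by (auto simp: embedded_prime_def)
qed

end
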